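(* Let $n$ be a positive integer. The following are equivalent. (a) Every $G\in\mathscr{G}_n$ admits a uniform cyclic group factorization, where $\mathscr{G}_n$ is the set of (isomorphism classes of) non-trivial finite groups of order at most $n$. (b) Every $G\in\mathscr{G}_n^{\dagger}$ admits a proper uniform group factorization, where $\mathscr{G}_n^{\dagger}$ is the subset of $\mathscr{G}_n$ consisting of those groups that are not cyclic of prime power order. (c) Every $G\in\mathscr{G}_n^{*}$ admits a proper uniform group factorization, where $\mathscr{G}_n^{*}$ is the subset of $\mathscr{G}_n^{\dagger}$ consisting of the simple groups in $\mathscr{G}_n^{\dagger}$.
   Context: Let $G$ be a finite group and $\mathcal{H}=(H_1,H_2,\ldots,H_k)$, $k\ge 1$, an ordered tuple of subsets of $G$. The multiplication map $\mathrm{mult}_{\mathcal{H}}:H_1\times H_2\times\cdots\times H_k\to G$ is defined by $\mathrm{mult}_{\mathcal{H}}(h_1,h_2,\ldots,h_k)=h_1h_2\cdots h_k$. The tuple $\mathcal{H}$ is a factorization of $G$ if $\mathrm{mult}_{\mathcal{H}}$ is surjective; it is proper if all of $H_1,\ldots,H_k$ are proper subsets of $G$. A factorization $\mathcal{H}$ is a uniform factorization of $G$ if $|\mathrm{mult}_{\mathcal{H}}^{-1}(g)|$ does not depend on $g\in G$. A uniform factorization is a uniform group factorization if all $H_i$ are subgroups of $G$, and a uniform cyclic group factorization if all $H_i$ are cyclic subgroups of $G$. A prime power is an integer $p^r$ with $p$ prime and $r\ge 1$. *)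

theory Defs
  imports
    "HOL-Algebra.Elementary_Groups"
    "HOL-Algebra.SimpleGroups"
    "HOL-Number_Theory.Prime_Powers"
begin

text \<open>
  An ordered tuple of subsets is a list of sets, and \<^term>\<open>listset Hs\<close> is the Cartesian product of
  the sets in \<^term>\<open>Hs\<close>, its elements being lists of the same length as \<^term>\<open>Hs\<close>.
\<close>

definition mult_map :: "('a, 'b) monoid_scheme \<Rightarrow> 'a list \<Rightarrow> 'a" where
  "mult_map G hs = foldr (\<otimes>\<^bsub>G\<^esub>) hs \<one>\<^bsub>G\<^esub>"

definition mult_fibre :: "('a, 'b) monoid_scheme \<Rightarrow> 'a set list \<Rightarrow> 'a \<Rightarrow> 'a list set" where
  "mult_fibre G Hs g = {hs \<in> listset Hs. mult_map G hs = g}"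

definition factorization :: "('a, 'b) monoid_scheme \<Rightarrow> 'a set list \<Rightarrow> bool" where
  "factorization G Hs \<longleftrightarrow>
     Hs \<noteq> [] \<and> (\<forall>H\<in>set Hs. H \<subseteq> carrier G) \<and> mult_map G ` listset Hs = carrier G"

definition proper_factorization :: "('a, 'b) monoid_scheme \<Rightarrow> 'a set list \<Rightarrow> bool" where
  "proper_factorization G Hs \<longleftrightarrow> factorization G Hs \<and> (\<forall>H\<in>set Hs. H \<subset> carrier G)"

definition uniform_factorization :: "('a, 'b) monoid_scheme \<Rightarrow> 'a set list \<Rightarrow> bool" where
  "uniform_factorization G Hs \<longleftrightarrow>
     factorization G Hs \<and>
     (\<forall>g\<in>carrier G. \<forall>g'\<in>carrier G. card (mult_fibre G Hs g) = card (mult_fibre G Hs g'))"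

definition uniform_group_factorization :: "('a, 'b) monoid_scheme \<Rightarrow> 'a set list \<Rightarrow> bool" where
  "uniform_group_factorization G Hs \<longleftrightarrow>
     uniform_factorization G Hs \<and> (\<forall>H\<in>set Hs. subgroup H G)"

definition uniform_cyclic_group_factorization :: "('a, 'b) monoid_scheme \<Rightarrow> 'a set list \<Rightarrow> bool" where
  "uniform_cyclic_group_factorization G Hs \<longleftrightarrow>
     uniform_factorization G Hs \<and>
     (\<forall>H\<in>set Hs. subgroup H G \<and> cyclic_group (G\<lparr>carrier := H\<rparr>))"

text \<open>
  Isomorphism classes are represented by groups whose carrier is a finite set of natural numbers.
  Each class has many representatives here; lemma \<open>groups_upto_represents\<close> below
  shows that no class is missed.
\<close>

definition groups_upto :: "nat \<Rightarrow> nat monoid set" where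
  "groups_upto n = {G. group G \<and> finite (carrier G) \<and> 1 < order G \<and> order G \<le> n}"

definition groups_upto_dagger :: "nat \<Rightarrow> nat monoid set" where
  "groups_upto_dagger n = {G \<in> groups_upto n. \<not> (cyclic_group G \<and> primepow (order G))}"

definition groups_upto_star :: "nat \<Rightarrow> nat monoid set" where
  "groups_upto_star n = {G \<in> groups_upto_dagger n. simple_group G}"

lemma groups_upto_represents:
  fixes G :: "('a, 'b) monoid_scheme"
  assumes "group G" "finite (carrier G)" "1 < order G" "order G \<le> n"
  shows "\<exists>G'\<in>groups_upto n. G \<cong> G'"
proof -
  interpret group G by fact
  obtain f :: "'a \<Rightarrow> nat" where f: "inj_on f (carrier G)"
    using finite_imp_inj_to_nat_seg[OF assms(2)] by blast
  define g where "g = inv_into (carrier G) f"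
  have gf: "g (f x) = x" if "x \<in> carrier G" for x
    using that f by (simp add: g_def)
  define G' :: "nat monoid" where
    "G' = \<lparr>carrier = f ` carrier G, monoid.mult = (\<lambda>x y. f (g x \<otimes>\<^bsub>G\<^esub> g y)), one = f \<one>\<^bsub>G\<^esub>\<rparr>"
  have iso: "f \<in> iso G G'"
    using f gf by (auto simp: iso_def hom_def bij_betw_def G'_def)
  have "group (G'\<lparr>one := f \<one>\<^bsub>G\<^esub>\<rparr>)"
    by (rule iso_imp_img_group[OF iso])
  then have "group G'"
    by (simp add: G'_def)
  moreover have "order G' = order G" "finite (carrier G')"
    using f assms(2) by (simp_all add: order_def G'_def card_image)
  ultimately show ?thesis
    using iso assms by (auto simp: groups_upto_def intro: is_isoI)
qed

end

theory Submission
  imports Defs "HOL-Algebra.Multiplicative_Group"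
begin

text \<open>
  Only two implications need an argument.

  \<^emph>\<open>Cyclic factorizations give proper ones.\<close> If \<open>G\<close> is not cyclic, then the members of a
  uniform cyclic group factorization are automatically proper. If \<open>G\<close> is cyclic but not of prime
  power order, write its order as \<open>a * b\<close> with coprime \<open>a, b > 1\<close>; the subgroups of order \<open>a\<close> and
  \<open>b\<close> form a proper uniform factorization (\<open>cyclic_coprime_factorization\<close>).

  \<^emph>\<open>Proper factorizations of simple groups give cyclic ones of all groups.\<close> Use induction on the
  order of \<open>G\<close>. A cyclic \<open>G\<close> is factored by itself. If \<open>G\<close> is simple and not cyclic, every member
  of its proper uniform factorization is a smaller group; replacing each member by a uniform
  cyclic factorization of it leaves the product uniform (\<open>product_sum_refine\<close>). If \<open>G\<close> has a
  normal subgroup \<open>N\<close> other than \<open>1\<close> and \<open>G\<close>, take uniform cyclic factorizations of \<open>N\<close> and of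
  \<open>G / N\<close>. Each cyclic \<open>C \<le> G / N\<close> is the image of a cyclic subgroup of \<open>G\<close>, generated by a preimage
  of a generator of \<open>C\<close>. The lifts cover the cosets of \<open>N\<close> evenly, since the fibres of a homomorphism
  on a subgroup have constant size, and appending the factors of \<open>N\<close> covers \<open>G\<close> evenly
  (\<open>evenly_covers_extension\<close>).

  All of this is bookkeeping with fibre sizes, which is done through the linear functional
  \<open>\<phi> \<mapsto> \<Sum> \<phi> (h\<^sub>1 \<cdots> h\<^sub>k)\<close>, the sum ranging over the Cartesian product of the tuple. A
  non-empty tuple of subsets of a finite group is a uniform factorization if and only if this
  functional is a positive multiple of summation over \<open>G\<close> (\<open>uniform_factorization_iff\<close>). In this form, concatenation of tuples is composition
  of functionals.
\<close>

section \<open>Summation over the products of a tuple\<close>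

text \<open>The sum of \<open>\<phi>\<close> over all products of elements chosen from the members of \<open>Hs\<close>, counted with
  multiplicity; meant for finite members, as sums over infinite sets are 0. Values in the natural
  numbers suffice because only fibre sizes matter.\<close>

definition product_sum :: "('a, 'b) monoid_scheme \<Rightarrow> 'a set list \<Rightarrow> ('a \<Rightarrow> nat) \<Rightarrow> nat" where
  "product_sum G Hs \<phi> = (\<Sum>hs\<in>listset Hs. \<phi> (mult_map G hs))"

text \<open>For finite \<open>A\<close> and finite members of \<open>Hs\<close>: every element of \<open>A\<close> is a product from \<open>Hs\<close> in
  the same positive number \<open>c\<close> of ways, and no other product occurs. Test functions stand in for the
  fibres.\<close>

definition evenly_covers :: "('a, 'b) monoid_scheme \<Rightarrow> 'a set list \<Rightarrow> 'a set \<Rightarrow> bool" where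
  "evenly_covers G Hs A \<longleftrightarrow> (\<exists>c>0. \<forall>\<phi>. product_sum G Hs \<phi> = c * sum \<phi> A)"

lemma listset_Cons_image: "listset (A # As) = (\<lambda>(x, xs). x # xs) ` (A \<times> listset As)"
  by (auto simp: set_Cons_def)

lemma finite_listset: "(\<And>A. A \<in> set As \<Longrightarrow> finite A) \<Longrightarrow> finite (listset As)"
  by (induction As) (simp_all add: listset_Cons_image del: listset.simps(2))

lemma mult_map_simps [simp]:
  "mult_map G [] = \<one>\<^bsub>G\<^esub>"
  "mult_map G (x # xs) = x \<otimes>\<^bsub>G\<^esub> mult_map G xs"
  by (simp_all add: mult_map_def)

lemma product_sum_Nil [simp]: "product_sum G [] \<phi> = \<phi> \<one>\<^bsub>G\<^esub>"
  by (simp add: product_sum_def)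

lemma product_sum_Cons [simp]:
  "product_sum G (H # Hs) \<phi> = (\<Sum>h\<in>H. product_sum G Hs (\<lambda>x. \<phi> (h \<otimes>\<^bsub>G\<^esub> x)))"
proof -
  have inj: "inj_on (\<lambda>(x, xs). x # xs) (H \<times> listset Hs)"
    by (auto simp: inj_on_def)
  show ?thesis
    unfolding product_sum_def listset_Cons_image sum.reindex[OF inj] sum.cartesian_product
    by (simp add: case_prod_unfold)
qed

lemma product_sum_carrier_update [simp]:
  "product_sum (G\<lparr>carrier := H\<rparr>) Hs \<phi> = product_sum G Hs \<phi>"
  by (simp add: product_sum_def mult_map_def)

context group
begin

lemma mult_map_closed:
  "\<lbrakk>hs \<in> listset Hs; \<And>H. H \<in> set Hs \<Longrightarrow> H \<subseteq> carrier G\<rbrakk> \<Longrightarrow> mult_map G hs \<in> carrier G"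
proof (induction Hs arbitrary: hs)
  case (Cons H Hs)
  then obtain x xs where "hs = x # xs" "x \<in> H" "xs \<in> listset Hs"
    by (auto simp: set_Cons_def)
  moreover have "mult_map G xs \<in> carrier G"
    using Cons \<open>xs \<in> listset Hs\<close> by simp
  ultimately show ?case using Cons.prems(2)[of H] by auto
qed simp

lemma product_sum_cong:
  assumes "\<And>H. H \<in> set Hs \<Longrightarrow> H \<subseteq> carrier G" "\<And>x. x \<in> carrier G \<Longrightarrow> \<phi> x = \<psi> x"
  shows "product_sum G Hs \<phi> = product_sum G Hs \<psi>"
  unfolding product_sum_def using assms mult_map_closed by (intro sum.cong) auto

lemma product_sum_append:
  assumes "\<And>H. H \<in> set (As @ Bs) \<Longrightarrow> H \<subseteq> carrier G"
  shows "product_sum G (As @ Bs) \<phi> = product_sum G As (\<lambda>a. product_sum G Bs (\<lambda>b. \<phi> (a \<otimes> b)))"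
  using assms
proof (induction As arbitrary: \<phi>)
  case Nil
  then show ?case by (simp, intro product_sum_cong) auto
next
  case (Cons A As)
  have "product_sum G (As @ Bs) (\<lambda>x. \<phi> (h \<otimes> x)) =
        product_sum G As (\<lambda>a. product_sum G Bs (\<lambda>b. \<phi> (h \<otimes> a \<otimes> b)))" if "h \<in> A" for h
  proof -
    have h: "h \<in> carrier G" using that Cons.prems by auto
    have "product_sum G (As @ Bs) (\<lambda>x. \<phi> (h \<otimes> x)) =
          product_sum G As (\<lambda>a. product_sum G Bs (\<lambda>b. \<phi> (h \<otimes> (a \<otimes> b))))"
      using Cons.prems by (intro Cons.IH) auto
    also have "\<dots> = product_sum G As (\<lambda>a. product_sum G Bs (\<lambda>b. \<phi> (h \<otimes> a \<otimes> b)))"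
      using Cons.prems h by (intro product_sum_cong) (auto simp: m_assoc)
    finally show ?thesis .
  qed
  then show ?case by simp
qed

lemma evenly_covers_self: "H \<subseteq> carrier G \<Longrightarrow> evenly_covers G [H] H"
  by (auto simp: evenly_covers_def subset_iff intro!: exI[of _ 1] sum.cong)

text \<open>Uniformity is positive proportionality of two functionals; the indicator functions of single
  elements recover the fibre sizes.\<close>

lemma uniform_factorization_iff:
  assumes fin: "finite (carrier G)"
  shows "uniform_factorization G Hs \<longleftrightarrow>
    Hs \<noteq> [] \<and> (\<forall>H\<in>set Hs. H \<subseteq> carrier G) \<and> evenly_covers G Hs (carrier G)"
proof (cases "Hs \<noteq> [] \<and> (\<forall>H\<in>set Hs. H \<subseteq> carrier G)")
  case False
  then show ?thesis unfolding uniform_factorization_def factorization_def by blast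
next
  case True
  let ?n = "\<lambda>g. card (mult_fibre G Hs g)"
  have sub: "\<And>H. H \<in> set Hs \<Longrightarrow> H \<subseteq> carrier G" using True by blast
  have finl: "finite (listset Hs)"
    using sub fin by (intro finite_listset) (auto intro: finite_subset)
  have img: "mult_map G ` listset Hs \<subseteq> carrier G"
    using mult_map_closed sub by auto
  have sum_eq: "product_sum G Hs \<phi> = (\<Sum>g\<in>carrier G. ?n g * \<phi> g)" for \<phi>
    unfolding product_sum_def
    by (subst sum.group[OF finl fin img, symmetric]) (simp add: mult_fibre_def)
  have pos: "?n g > 0 \<longleftrightarrow> g \<in> mult_map G ` listset Hs" for g
    using finl by (auto simp: card_gt_0_iff mult_fibre_def)
  have unif: "uniform_factorization G Hs \<longleftrightarrow> (\<exists>c>0. \<forall>g\<in>carrier G. ?n g = c)"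
  proof
    assume "uniform_factorization G Hs"
    then have const: "\<forall>g\<in>carrier G. ?n g = ?n \<one>" and onto: "mult_map G ` listset Hs = carrier G"
      unfolding uniform_factorization_def factorization_def using one_closed by blast+
    have "?n \<one> > 0" unfolding pos onto by (rule one_closed)
    with const show "\<exists>c>0. \<forall>g\<in>carrier G. ?n g = c" by blast
  next
    assume "\<exists>c>0. \<forall>g\<in>carrier G. ?n g = c"
    then obtain c where c: "c > 0" "\<And>g. g \<in> carrier G \<Longrightarrow> ?n g = c" by blast
    then have "carrier G \<subseteq> mult_map G ` listset Hs" using pos by (metis subsetI)
    then show "uniform_factorization G Hs"
      unfolding uniform_factorization_def factorization_def using True img c(2) by simp
  qed
  also have "\<dots> \<longleftrightarrow> evenly_covers G Hs (carrier G)"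
  proof
    assume "\<exists>c>0. \<forall>g\<in>carrier G. ?n g = c"
    then show "evenly_covers G Hs (carrier G)"
      by (auto simp: evenly_covers_def sum_eq sum_distrib_left)
  next
    assume "evenly_covers G Hs (carrier G)"
    then obtain c where c: "c > 0" "\<And>\<phi>. product_sum G Hs \<phi> = c * sum \<phi> (carrier G)"
      by (auto simp: evenly_covers_def)
    have "?n g = c" if "g \<in> carrier G" for g
      using c(2)[of "\<lambda>x. if x = g then 1 else 0"] that fin by (simp add: sum_eq if_distrib cong: if_cong)
    then show "\<exists>c>0. \<forall>g\<in>carrier G. ?n g = c" using c(1) by blast
  qed
  finally show ?thesis using True by blast
qed

section \<open>Refining a factorization\<close>

text \<open>Replacing each member \<open>H\<close> of a tuple by a tuple \<open>f H\<close> that covers \<open>H\<close> evenly multiplies the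
  functional by a constant.\<close>

lemma product_sum_refine:
  assumes "\<And>H. H \<in> set Hs \<Longrightarrow> H \<subseteq> carrier G \<and> evenly_covers G (f H) H"
    and "\<And>H K. \<lbrakk>H \<in> set Hs; K \<in> set (f H)\<rbrakk> \<Longrightarrow> K \<subseteq> carrier G"
  shows "\<exists>c>0. \<forall>\<phi>. product_sum G (concat (map f Hs)) \<phi> = c * product_sum G Hs \<phi>"
  using assms
proof (induction Hs)
  case Nil
  then show ?case by auto
next
  case (Cons H Hs)
  obtain c where c: "c > 0"
    "\<And>\<phi>. product_sum G (concat (map f Hs)) \<phi> = c * product_sum G Hs \<phi>"
  proof -
    have "\<exists>c>0. \<forall>\<phi>. product_sum G (concat (map f Hs)) \<phi> = c * product_sum G Hs \<phi>"
    proof (rule Cons.IH)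
      show "K \<subseteq> carrier G" if "H' \<in> set Hs" "K \<in> set (f H')" for H' K
        using Cons.prems(2)[of H' K] that by simp
    qed (simp add: Cons.prems(1))
    then show thesis using that by blast
  qed
  obtain d where d: "d > 0" "\<And>\<phi>. product_sum G (f H) \<phi> = d * sum \<phi> H"
    using Cons.prems(1)[of H] by (auto simp: evenly_covers_def)
  have "product_sum G (concat (map f (H # Hs))) \<phi> = (d * c) * product_sum G (H # Hs) \<phi>" for \<phi>
  proof -
    have "product_sum G (concat (map f (H # Hs))) \<phi> =
          product_sum G (f H) (\<lambda>a. product_sum G (concat (map f Hs)) (\<lambda>b. \<phi> (a \<otimes> b)))"
      using Cons.prems(2) by (simp, subst product_sum_append) auto
    then show ?thesis by (simp add: c(2) d(2) sum_distrib_left mult.assoc)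
  qed
  then show ?case using c(1) d(1) by (intro exI[of _ "d * c"]) auto
qed

lemma evenly_covers_refine:
  assumes "evenly_covers G Hs A"
    and "\<And>H. H \<in> set Hs \<Longrightarrow> H \<subseteq> carrier G \<and> evenly_covers G (f H) H"
    and "\<And>H K. \<lbrakk>H \<in> set Hs; K \<in> set (f H)\<rbrakk> \<Longrightarrow> K \<subseteq> carrier G"
  shows "evenly_covers G (concat (map f Hs)) A"
proof -
  have "\<exists>c>0. \<forall>\<phi>. product_sum G (concat (map f Hs)) \<phi> = c * product_sum G Hs \<phi>"
    by (rule product_sum_refine) (fact assms)+
  then obtain c where c: "c > 0"
    "\<And>\<phi>. product_sum G (concat (map f Hs)) \<phi> = c * product_sum G Hs \<phi>" by blast
  obtain d where d: "d > 0" "\<And>\<phi>. product_sum G Hs \<phi> = d * sum \<phi> A"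
    using assms(1) unfolding evenly_covers_def by blast
  have "\<forall>\<phi>. product_sum G (concat (map f Hs)) \<phi> = c * d * sum \<phi> A"
    by (simp add: c(2) d(2))
  then show ?thesis
    unfolding evenly_covers_def using c(1) d(1) by (intro exI[of _ "c * d"]) simp
qed

lemma cyclic_subgroup_iff:
  assumes "subgroup H G"
  shows "cyclic_group (G\<lparr>carrier := H\<rparr>) \<longleftrightarrow> (\<exists>x\<in>H. H = generate G {x})"
proof -
  interpret H: group "G\<lparr>carrier := H\<rparr>"
    using assms by (rule subgroup_imp_group)
  have "generate G {x} = range (\<lambda>n::int. x [^]\<^bsub>G\<lparr>carrier := H\<rparr>\<^esub> n)" if "x \<in> H" for x
    using that assms subgroup.mem_carrier[OF assms that]
    by (auto simp: generate_pow int_pow_consistent)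
  then show ?thesis by (auto simp: H.cyclic_group)
qed

text \<open>A uniform cyclic group factorization of a subgroup, read inside the whole group.\<close>

lemma uniform_cyclic_group_factorization_subgroup:
  assumes fin: "finite (carrier G)" and H: "subgroup H G"
    and u: "uniform_cyclic_group_factorization (G\<lparr>carrier := H\<rparr>) Ks"
  shows "evenly_covers G Ks H"
    and "\<And>K. K \<in> set Ks \<Longrightarrow> subgroup K G \<and> cyclic_group (G\<lparr>carrier := K\<rparr>)"
proof -
  interpret H: group "G\<lparr>carrier := H\<rparr>"
    using H by (rule subgroup_imp_group)
  have finH: "finite (carrier (G\<lparr>carrier := H\<rparr>))"
    using finite_subset[OF subgroup.subset[OF H] fin] by simp
  show "evenly_covers G Ks H"
    using u unfolding uniform_cyclic_group_factorization_def H.uniform_factorization_iff[OF finH]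
    by (simp add: evenly_covers_def)
  show "subgroup K G \<and> cyclic_group (G\<lparr>carrier := K\<rparr>)" if "K \<in> set Ks" for K
    using u that incl_subgroup[OF H] by (auto simp: uniform_cyclic_group_factorization_def)
qed

lemma uniform_cyclic_group_factorization_iff:
  assumes "finite (carrier G)"
  shows "uniform_cyclic_group_factorization G Hs \<longleftrightarrow>
    Hs \<noteq> [] \<and> evenly_covers G Hs (carrier G) \<and>
    (\<forall>H\<in>set Hs. subgroup H G \<and> cyclic_group (G\<lparr>carrier := H\<rparr>))"
  by (auto simp: uniform_cyclic_group_factorization_def uniform_factorization_iff[OF assms]
      dest: subgroup.subset)

lemma uniform_cyclic_group_factorization_refine:
  assumes fin: "finite (carrier G)" and ne: "Hs \<noteq> []" and ev: "evenly_covers G Hs (carrier G)"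
    and sub: "\<And>H. H \<in> set Hs \<Longrightarrow> subgroup H G"
    and ex: "\<And>H. H \<in> set Hs \<Longrightarrow> \<exists>Ks. uniform_cyclic_group_factorization (G\<lparr>carrier := H\<rparr>) Ks"
  shows "\<exists>Ks. uniform_cyclic_group_factorization G Ks"
proof -
  define f where "f H = (SOME Ks. uniform_cyclic_group_factorization (G\<lparr>carrier := H\<rparr>) Ks)" for H
  have f: "uniform_cyclic_group_factorization (G\<lparr>carrier := H\<rparr>) (f H)" if "H \<in> set Hs" for H
    unfolding f_def using ex[OF that] by (rule someI_ex)
  have fne: "f H \<noteq> []" if "H \<in> set Hs" for H
    using f[OF that]
    unfolding uniform_cyclic_group_factorization_def uniform_factorization_def factorization_def
    by blast
  note * = uniform_cyclic_group_factorization_subgroup[OF fin sub f]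
  have "evenly_covers G (concat (map f Hs)) (carrier G)"
    using ev
  proof (rule evenly_covers_refine)
    show "H \<subseteq> carrier G \<and> evenly_covers G (f H) H" if "H \<in> set Hs" for H
      using that subgroup.subset[OF sub] *(1) by blast
    show "K \<subseteq> carrier G" if "H \<in> set Hs" "K \<in> set (f H)" for H K
      using *(2)[OF that(1,1,2)] subgroup.subset by blast
  qed
  moreover have "concat (map f Hs) \<noteq> []"
    using ne fne by (cases Hs) auto
  ultimately have "uniform_cyclic_group_factorization G (concat (map f Hs))"
    unfolding uniform_cyclic_group_factorization_iff[OF fin] using * by auto
  then show ?thesis ..
qed

end

section \<open>Lifting a factorization along an epimorphism\<close>

context group_hom
begin

lemma fibre_on_subgroup:
  assumes X: "subgroup X G" and x: "x \<in> X"
  shows "bij_betw ((\<otimes>) x) {k \<in> X. h k = \<one>\<^bsub>H\<^esub>} {y \<in> X. h y = h x}"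
proof -
  have mem: "\<And>y. y \<in> X \<Longrightarrow> y \<in> carrier G" using subgroup.mem_carrier[OF X] .
  have "(\<otimes>) x ` {k \<in> X. h k = \<one>\<^bsub>H\<^esub>} = {y \<in> X. h y = h x}"
  proof safe
    fix y assume y: "y \<in> X" "h y = h x"
    have "y = x \<otimes> (inv x \<otimes> y)"
      using mem[OF x] mem[OF y(1)] by (simp flip: G.m_assoc)
    moreover have "inv x \<otimes> y \<in> X" "h (inv x \<otimes> y) = \<one>\<^bsub>H\<^esub>"
      using x y mem X by (simp_all add: subgroup.m_closed subgroup.m_inv_closed)
    ultimately show "y \<in> (\<otimes>) x ` {k \<in> X. h k = \<one>\<^bsub>H\<^esub>}" by blast
  qed (use x mem X in \<open>simp_all add: subgroup.m_closed\<close>)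
  moreover have "inj_on ((\<otimes>) x) {k \<in> X. h k = \<one>\<^bsub>H\<^esub>}"
    using x mem by (auto intro!: inj_onI)
  ultimately show ?thesis by (simp add: bij_betw_def)
qed

lemma sum_over_subgroup_image:
  assumes X: "subgroup X G" and fin: "finite X"
  shows "(\<Sum>x\<in>X. \<psi> (h x)) = card {k \<in> X. h k = \<one>\<^bsub>H\<^esub>} * sum \<psi> (h ` X)"
proof -
  have "(\<Sum>x\<in>X. \<psi> (h x)) = (\<Sum>q\<in>h ` X. \<Sum>x\<in>{x \<in> X. h x = q}. \<psi> (h x))"
    using fin by (rule sum.image_gen)
  also have "\<dots> = (\<Sum>q\<in>h ` X. card {k \<in> X. h k = \<one>\<^bsub>H\<^esub>} * \<psi> q)"
  proof (rule sum.cong)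
    fix q assume "q \<in> h ` X"
    then obtain x where "x \<in> X" "q = h x" by blast
    then show "(\<Sum>x\<in>{x \<in> X. h x = q}. \<psi> (h x)) = card {k \<in> X. h k = \<one>\<^bsub>H\<^esub>} * \<psi> q"
      using bij_betw_same_card[OF fibre_on_subgroup[OF X]] by simp
  qed simp
  finally show ?thesis by (simp add: sum_distrib_left)
qed

text \<open>The constant is the product of the orders of the kernels of the restrictions to the members.\<close>

lemma product_sum_image:
  assumes "\<And>X. X \<in> set Xs \<Longrightarrow> subgroup X G" "finite (carrier G)"
  shows "\<exists>c>0. \<forall>\<psi>. product_sum G Xs (\<lambda>x. \<psi> (h x)) = c * product_sum H (map ((`) h) Xs) \<psi>"
  using assms
proof (induction Xs)
  case Nil
  then show ?case by (auto intro: exI[of _ 1])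
next
  case (Cons X Xs)
  obtain c where c: "c > 0"
    "\<And>\<psi>. product_sum G Xs (\<lambda>x. \<psi> (h x)) = c * product_sum H (map ((`) h) Xs) \<psi>"
    using Cons by auto
  have X: "subgroup X G" using Cons.prems by simp
  have finX: "finite X" using finite_subset[OF subgroup.subset[OF X]] Cons.prems by simp
  let ?k = "card {k \<in> X. h k = \<one>\<^bsub>H\<^esub>}"
  have k: "?k > 0"
    using finX subgroup.one_closed[OF X] by (auto simp: card_gt_0_iff intro!: exI[of _ \<one>])
  have "product_sum G (X # Xs) (\<lambda>x. \<psi> (h x)) =
        c * ?k * product_sum H (map ((`) h) (X # Xs)) \<psi>" for \<psi>
  proof -
    have "product_sum G Xs (\<lambda>y. \<psi> (h (x \<otimes> y))) =
          c * product_sum H (map ((`) h) Xs) (\<lambda>q. \<psi> (h x \<otimes>\<^bsub>H\<^esub> q))" if "x \<in> X" for x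
    proof -
      have "product_sum G Xs (\<lambda>y. \<psi> (h (x \<otimes> y))) = product_sum G Xs (\<lambda>y. \<psi> (h x \<otimes>\<^bsub>H\<^esub> h y))"
        using Cons.prems that subgroup.mem_carrier[OF X that]
        by (intro G.product_sum_cong) (auto dest: subgroup.subset)
      then show ?thesis by (simp add: c(2)[of "\<lambda>q. \<psi> (h x \<otimes>\<^bsub>H\<^esub> q)"])
    qed
    then have "product_sum G (X # Xs) (\<lambda>x. \<psi> (h x)) =
        c * (\<Sum>x\<in>X. product_sum H (map ((`) h) Xs) (\<lambda>q. \<psi> (h x \<otimes>\<^bsub>H\<^esub> q)))"
      by (simp add: sum_distrib_left)
    then show ?thesis
      by (simp add: mult.assoc
          sum_over_subgroup_image[OF X finX, of "\<lambda>r. product_sum H (map ((`) h) Xs) (\<lambda>q. \<psi> (r \<otimes>\<^bsub>H\<^esub> q))"])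
  qed
  then show ?case using c(1) k by (intro exI[of _ "c * ?k"]) auto
qed

text \<open>A product from \<open>Xs\<close> followed by an element of the kernel runs through a whole fibre of the
  homomorphism; summing over the fibre turns a test function on \<open>G\<close> into one on the image.\<close>

lemma evenly_covers_extension:
  assumes Xs: "\<And>X. X \<in> set Xs \<Longrightarrow> subgroup X G" and fin: "finite (carrier G)"
    and surj: "h ` carrier G = carrier H"
    and ev: "evenly_covers H (map ((`) h) Xs) (carrier H)"
  shows "evenly_covers G (Xs @ [kernel G H h]) (carrier G)"
proof -
  let ?N = "kernel G H h"
  obtain c where c: "c > 0"
    "\<And>\<psi>. product_sum G Xs (\<lambda>x. \<psi> (h x)) = c * product_sum H (map ((`) h) Xs) \<psi>"
    using product_sum_image[OF Xs fin] by blast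
  obtain d where d: "d > 0" "\<And>\<psi>. product_sum H (map ((`) h) Xs) \<psi> = d * sum \<psi> (carrier H)"
    using ev by (auto simp: evenly_covers_def)
  have sub: "X \<subseteq> carrier G" if "X \<in> set Xs" for X
    using Xs[OF that] by (rule subgroup.subset)
  have N: "?N = {k \<in> carrier G. h k = \<one>\<^bsub>H\<^esub>}"
    by (simp add: kernel_def)
  have "product_sum G (Xs @ [?N]) \<phi> = c * d * sum \<phi> (carrier G)" for \<phi>
  proof -
    define \<psi> where "\<psi> q = (\<Sum>x\<in>{x \<in> carrier G. h x = q}. \<phi> x)" for q
    have inner: "product_sum G [?N] (\<lambda>b. \<phi> (a \<otimes> b)) = \<psi> (h a)" if a: "a \<in> carrier G" for a
    proof -
      have "product_sum G [?N] (\<lambda>b. \<phi> (a \<otimes> b)) = (\<Sum>b\<in>?N. \<phi> (a \<otimes> b))"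
        using a by (auto simp: N intro!: sum.cong)
      also have "\<dots> = \<psi> (h a)"
        unfolding \<psi>_def N
        by (rule sum.reindex_bij_betw[OF fibre_on_subgroup[OF G.subgroup_self a]])
      finally show ?thesis .
    qed
    have "product_sum G (Xs @ [?N]) \<phi> =
          product_sum G Xs (\<lambda>a. product_sum G [?N] (\<lambda>b. \<phi> (a \<otimes> b)))"
      using sub by (intro G.product_sum_append) (auto simp: kernel_def)
    also have "\<dots> = product_sum G Xs (\<lambda>a. \<psi> (h a))"
      using sub inner by (intro G.product_sum_cong) auto
    also have "\<dots> = c * d * sum \<psi> (carrier H)"
      by (simp add: c(2) d(2))
    also have "sum \<psi> (carrier H) = sum \<phi> (carrier G)"
      unfolding \<psi>_def using fin finite_imageI[OF fin, of h] surj by (intro sum.group) simp_all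
    finally show ?thesis .
  qed
  then show ?thesis
    unfolding evenly_covers_def using c(1) d(1) by (intro exI[of _ "c * d"]) auto
qed

lemma cyclic_subgroup_lift:
  assumes surj: "h ` carrier G = carrier H"
    and C: "subgroup C H" "cyclic_group (H\<lparr>carrier := C\<rparr>)"
  shows "\<exists>X. subgroup X G \<and> cyclic_group (G\<lparr>carrier := X\<rparr>) \<and> h ` X = C"
proof -
  obtain q where q: "q \<in> C" "C = generate H {q}"
    using C H.cyclic_subgroup_iff by blast
  then have "q \<in> h ` carrier G"
    using surj subgroup.mem_carrier[OF C(1)] by simp
  then obtain x where x: "x \<in> carrier G" "h x = q" by blast
  have X: "subgroup (generate G {x}) G"
    using x by (intro G.generate_is_subgroup) simp
  have "x \<in> generate G {x}" by (auto intro: generate.incl)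
  then have "cyclic_group (G\<lparr>carrier := generate G {x}\<rparr>)"
    using G.cyclic_subgroup_iff[OF X] by blast
  moreover have "h ` generate G {x} = C"
    using generate_img[of "{x}"] x q by simp
  ultimately show ?thesis using X by blast
qed

lemma uniform_cyclic_group_factorization_extension:
  assumes fin: "finite (carrier G)" and surj: "h ` carrier G = carrier H"
    and Cs: "uniform_cyclic_group_factorization H Cs"
    and Ks: "uniform_cyclic_group_factorization (G\<lparr>carrier := kernel G H h\<rparr>) Ks"
  shows "\<exists>Hs. uniform_cyclic_group_factorization G Hs"
proof -
  have finH: "finite (carrier H)" using finite_imageI[OF fin, of h] by (simp add: surj)
  note Cs' = Cs[unfolded H.uniform_cyclic_group_factorization_iff[OF finH]]
  have "\<forall>C\<in>set Cs. \<exists>X. subgroup X G \<and> cyclic_group (G\<lparr>carrier := X\<rparr>) \<and> h ` X = C"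
    using Cs' cyclic_subgroup_lift[OF surj] by blast
  then obtain l where
    l: "\<And>C. C \<in> set Cs \<Longrightarrow> subgroup (l C) G \<and> cyclic_group (G\<lparr>carrier := l C\<rparr>) \<and> h ` l C = C"
    by metis
  have "map ((`) h) (map l Cs) = Cs"
    using l by (simp add: map_idI)
  then have ev: "evenly_covers G (map l Cs @ [kernel G H h]) (carrier G)"
    using l Cs' fin surj by (intro evenly_covers_extension) auto
  have "\<exists>Ks. uniform_cyclic_group_factorization (G\<lparr>carrier := X\<rparr>) Ks" if "X \<in> l ` set Cs" for X
  proof -
    have X: "subgroup X G" "cyclic_group (G\<lparr>carrier := X\<rparr>)" using that l by auto
    interpret X: group "G\<lparr>carrier := X\<rparr>" using X(1) by (rule G.subgroup_imp_group)
    have "finite X" using finite_subset[OF subgroup.subset[OF X(1)] fin] .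
    then have "uniform_cyclic_group_factorization (G\<lparr>carrier := X\<rparr>) [X]"
      using X X.subgroup_self X.evenly_covers_self[of X]
      by (simp add: X.uniform_cyclic_group_factorization_iff)
    then show ?thesis ..
  qed
  then show ?thesis
    using Ks l by (intro G.uniform_cyclic_group_factorization_refine[OF fin _ ev])
      (auto intro: subgroup_kernel)
qed

end

section \<open>Cyclic groups whose order is not a prime power\<close>

lemma coprime_decomposition:
  fixes m :: nat
  assumes "m > 1" "\<not> primepow m"
  obtains a b where "m = a * b" "coprime a b" "a > 1" "b > 1"
proof -
  obtain p where p: "prime p" "p dvd m" using assms prime_factor_nat[of m] by auto
  have "m \<noteq> 0" "\<not> is_unit p" using assms(1) p(1) by (auto simp: prime_nat_iff)
  then obtain b where b: "m = p ^ multiplicity p m * b" "\<not> p dvd b"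
    by (rule multiplicity_decompose')
  have mult: "multiplicity p m > 0"
    using p b by (cases "multiplicity p m = 0") auto
  have "b \<noteq> 1"
    using assms(2) b(1) mult p(1) by (metis mult.right_neutral primepow_prime_power)
  moreover have "b \<noteq> 0" using assms(1) b(1) by (intro notI) simp
  moreover have "p ^ multiplicity p m > 1"
    using mult prime_gt_1_nat[OF p(1)] by (rule one_less_power[rotated])
  moreover have "coprime (p ^ multiplicity p m) b"
    using p(1) b(2) by (simp add: prime_imp_coprime)
  ultimately show thesis using b(1) by (intro that[of "p ^ multiplicity p m" b]) simp_all
qed

lemma (in group) cyclic_coprime_factorization:
  assumes fin: "finite (carrier G)" and gt: "order G > 1"
    and cyc: "cyclic_group G" and np: "\<not> primepow (order G)"
  shows "\<exists>Hs. proper_factorization G Hs \<and> uniform_group_factorization G Hs"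
proof -
  obtain g where g: "g \<in> carrier G" and car: "carrier G = range (\<lambda>n::int. g [^] n)"
    using cyc by (auto simp: cyclic_group)
  obtain a b where ab: "order G = a * b" "coprime a b" "a > 1" "b > 1"
    using coprime_decomposition[OF gt np] .
  have "generate G {g} = carrier G"
    using car by (auto simp: generate_pow[OF g])
  then have ordg: "ord g = a * b"
    using generate_pow_card[OF g] ab(1) by (simp add: order_def)
  define A where "A = generate G {g [^] b}"
  define B where "B = generate G {g [^] a}"
  have sub: "subgroup A G" "subgroup B G"
    unfolding A_def B_def using g by (auto intro!: generate_is_subgroup)
  have cards: "card A = a" "card B = b"
    using ordg ab g by (simp_all add: A_def B_def ord_pow flip: generate_pow_card)
  have fins: "finite A" "finite B"
    using sub fin by (auto dest!: subgroup.subset intro: finite_subset)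
  have proper: "A \<subset> carrier G" "B \<subset> carrier G"
    using sub cards ab by (auto dest: subgroup.subset simp: order_def)
  \<comment> \<open>Multiplication is onto by Bezout's identity, hence bijective by counting.\<close>
  let ?m = "\<lambda>(x, y). x \<otimes> y"
  have "?m ` (A \<times> B) = carrier G"
  proof
    show "?m ` (A \<times> B) \<subseteq> carrier G"
      using sub by (auto dest: subgroup.mem_carrier)
    show "carrier G \<subseteq> ?m ` (A \<times> B)"
    proof
      fix x assume "x \<in> carrier G"
      then obtain n :: int where n: "x = g [^] n" using car by auto
      obtain u v :: int where uv: "u * int a + v * int b = 1"
        using bezout_int[of "int a" "int b"] ab(2) by auto
      have "n = int b * (v * n) + int a * (u * n)"
        using arg_cong[OF uv, of "\<lambda>t. t * n"] by (simp add: algebra_simps)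
      then have "x = g [^] (int b * (v * n) + int a * (u * n))" using n by simp
      also have "\<dots> = (g [^] b) [^] (v * n) \<otimes> (g [^] a) [^] (u * n)"
        using g by (simp add: int_pow_mult int_pow_pow flip: int_pow_int)
      finally show "x \<in> ?m ` (A \<times> B)"
        using g by (force simp: A_def B_def generate_pow)
    qed
  qed
  moreover from this have "inj_on ?m (A \<times> B)"
    using fins cards ab by (intro eq_card_imp_inj_on) (auto simp: order_def card_cartesian_product)
  ultimately have bij: "bij_betw ?m (A \<times> B) (carrier G)" by (simp add: bij_betw_def)
  have "product_sum G [A, B] \<phi> = sum \<phi> (carrier G)" for \<phi>
  proof -
    have "product_sum G [A, B] \<phi> = (\<Sum>x\<in>A. \<Sum>y\<in>B. \<phi> (x \<otimes> y))"
      using sub by (auto intro!: sum.cong dest: subgroup.mem_carrier)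
    also have "\<dots> = (\<Sum>z\<in>A \<times> B. \<phi> (?m z))"
      by (simp add: sum.cartesian_product case_prod_unfold)
    also have "\<dots> = sum \<phi> (carrier G)"
      by (rule sum.reindex_bij_betw[OF bij])
    finally show ?thesis .
  qed
  then have "evenly_covers G [A, B] (carrier G)"
    by (auto simp: evenly_covers_def intro!: exI[of _ 1])
  then have "uniform_factorization G [A, B]"
    using proper by (auto simp: uniform_factorization_iff[OF fin])
  moreover from this have "factorization G [A, B]"
    unfolding uniform_factorization_def by blast
  ultimately have "proper_factorization G [A, B] \<and> uniform_group_factorization G [A, B]"
    using sub proper by (simp add: proper_factorization_def uniform_group_factorization_def)
  then show ?thesis ..
qed

section \<open>Induction on the group order\<close>

lemma (in group) normal_proper_quotient:
  assumes fin: "finite (carrier G)" and N: "N \<lhd> G" "N \<noteq> carrier G" "N \<noteq> {\<one>}"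
  shows "card N < order G" "1 < order (G Mod N)" "order (G Mod N) < order G"
proof -
  have sub: "subgroup N G" using N(1) by (simp add: normal_def)
  have finN: "finite N" using finite_subset[OF subgroup.subset[OF sub] fin] .
  show lt: "card N < order G"
    unfolding order_def using fin subgroup.subset[OF sub] N(2) by (intro psubset_card_mono) auto
  have "card N \<noteq> 1"
    using subgroup.one_closed[OF sub] N(3) by (auto simp: card_1_singleton_iff)
  moreover have "card N \<noteq> 0" using finN subgroup.one_closed[OF sub] by auto
  ultimately have gt: "card N > 1" by simp
  have eq: "order (G Mod N) * card N = order G"
    using lagrange[OF sub] by (simp add: order_def FactGroup_def)
  then show "1 < order (G Mod N)"
    using lt by (metis less_one linorder_neqE_nat mult_1 mult_0 not_less_zero less_irrefl)
  then have "order (G Mod N) * 1 < order (G Mod N) * card N"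
    using gt by (intro mult_strict_left_mono) auto
  then show "order (G Mod N) < order G" using eq by simp
qed

text \<open>The trivial group is included, since the members of a factorization may be trivial.\<close>

lemma uniform_cyclic_group_factorization_exists:
  fixes G :: "nat monoid"
  assumes star: "\<forall>G\<in>groups_upto_star n. \<exists>Hs. proper_factorization G Hs \<and> uniform_group_factorization G Hs"
    and "group G" "finite (carrier G)" "order G \<le> n"
  shows "\<exists>Hs. uniform_cyclic_group_factorization G Hs"
  using assms(2-)
proof (induction "order G" arbitrary: G rule: less_induct)
  case less
  interpret group G by fact
  note fin = less.prems(2)
  have IH_subgroup: "\<exists>Ks. uniform_cyclic_group_factorization (G\<lparr>carrier := H\<rparr>) Ks"
    if H: "subgroup H G" "H \<noteq> carrier G" for H
  proof (rule less.hyps)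
    have "card H < order G"
      unfolding order_def using fin subgroup.subset[OF H(1)] H(2) by (intro psubset_card_mono) auto
    then show "order (G\<lparr>carrier := H\<rparr>) < order G" "order (G\<lparr>carrier := H\<rparr>) \<le> n"
      using less.prems(3) by (simp_all add: order_def)
    show "group (G\<lparr>carrier := H\<rparr>)" using H(1) by (rule subgroup_imp_group)
    show "finite (carrier (G\<lparr>carrier := H\<rparr>))"
      using finite_subset[OF subgroup.subset[OF H(1)] fin] by simp
  qed
  consider "cyclic_group G" | "\<not> cyclic_group G" "simple_group G"
    | "\<not> cyclic_group G" "\<not> simple_group G" by blast
  then show ?case
  proof cases
    case 1
    then have "uniform_cyclic_group_factorization G [carrier G]"
      by (simp add: uniform_cyclic_group_factorization_iff[OF fin] evenly_covers_self subgroup_self)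
    then show ?thesis ..
  next
    case 2
    then have "G \<in> groups_upto_star n"
      using less.prems simple_group.order_gt_one
      by (auto simp: groups_upto_star_def groups_upto_dagger_def groups_upto_def)
    then obtain Hs where Hs: "proper_factorization G Hs" "uniform_group_factorization G Hs"
      using star by blast
    then have "Hs \<noteq> []" "evenly_covers G Hs (carrier G)"
      and sub: "\<And>H. H \<in> set Hs \<Longrightarrow> subgroup H G \<and> H \<noteq> carrier G"
      by (auto simp: proper_factorization_def uniform_group_factorization_def
          uniform_factorization_iff[OF fin])
    then show ?thesis
      using IH_subgroup by (intro uniform_cyclic_group_factorization_refine[OF fin]) auto
  next
    case 3
    have "order G \<noteq> 1"
    proof
      assume "order G = 1"
      then have "trivial_group G"
        using one_closed
        by (metis card_1_singletonE is_group order_def singletonD trivial_group_def)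
      then show False using 3 trivial_imp_cyclic_group by blast
    qed
    moreover have "order G > 0" using fin by (simp add: order_gt_0_iff_finite)
    ultimately have "order G > 1" by simp
    then obtain N where N: "N \<lhd> G" "N \<noteq> carrier G" "N \<noteq> {\<one>\<^bsub>G\<^esub>}"
      using 3(2) by (auto simp: simple_group_def simple_group_axioms_def)
    interpret N: normal N G by (rule N(1))
    note ord = normal_proper_quotient[OF fin N]
    \<comment> \<open>The cosets are sets of natural numbers, so the quotient is replaced by an isomorphic copy \<open>Q\<close>
      whose elements are natural numbers, to which the induction hypothesis applies.\<close>
    have "\<exists>Q\<in>groups_upto n. G Mod N \<cong> Q"
      using ord less.prems(3) N.factorgroup_is_group
      by (intro groups_upto_represents) (auto intro: card_ge_0_finite simp: order_def)
    then obtain Q i where Q: "Q \<in> groups_upto n" and i: "i \<in> iso (G Mod N) Q"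
      by (auto simp: is_iso_def)
    have Qg: "group Q" "finite (carrier Q)" "order Q \<le> n" using Q by (auto simp: groups_upto_def)
    have "order Q = order (G Mod N)"
      using iso_same_card[OF is_isoI[OF i]] by (simp add: order_def)
    then obtain Cs where Cs: "uniform_cyclic_group_factorization Q Cs"
      using less.hyps[OF _ Qg] ord by auto
    define \<pi> where "\<pi> = i \<circ> (#>\<^bsub>G\<^esub>) N"
    have hom: "\<pi> \<in> hom G Q"
      unfolding \<pi>_def using i N.r_coset_hom_Mod by (intro Group.hom_compose) (auto simp: iso_def)
    interpret \<pi>: group_hom G Q \<pi>
      using hom Qg(1) by (simp add: group_hom_def group_hom_axioms_def is_group)
    have carMod: "carrier (G Mod N) = (\<lambda>x. N #>\<^bsub>G\<^esub> x) ` carrier G"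
      by (auto simp: FactGroup_def RCOSETS_def)
    have bij: "bij_betw i (carrier (G Mod N)) (carrier Q)"
      using i by (simp add: iso_def)
    have surj: "\<pi> ` carrier G = carrier Q"
      using bij_betw_imp_surj_on[OF bij] by (simp add: \<pi>_def carMod image_comp)
    interpret i: group_hom "G Mod N" Q i
      using i Qg(1) N.factorgroup_is_group by (simp add: group_hom_def group_hom_axioms_def iso_def)
    have ker: "kernel G Q \<pi> = N"
    proof -
      have "\<pi> x = \<one>\<^bsub>Q\<^esub> \<longleftrightarrow> x \<in> N" if x: "x \<in> carrier G" for x
      proof -
        have "\<pi> x = \<one>\<^bsub>Q\<^esub> \<longleftrightarrow> i (N #>\<^bsub>G\<^esub> x) = i N"
          using i.hom_one by (simp add: \<pi>_def FactGroup_def)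
        also have "\<dots> \<longleftrightarrow> N #>\<^bsub>G\<^esub> x = N"
          using bij_betw_imp_inj_on[OF bij] x N.subgroup_in_rcosets
          by (intro inj_on_eq_iff) (auto simp: FactGroup_def RCOSETS_def)
        also have "\<dots> \<longleftrightarrow> x \<in> N"
          using x coset_join1 coset_join2 N.subgroup_axioms by blast
        finally show ?thesis .
      qed
      then show ?thesis using N.subset by (auto simp: kernel_def)
    qed
    obtain Ks where "uniform_cyclic_group_factorization (G\<lparr>carrier := N\<rparr>) Ks"
      using IH_subgroup[OF N.subgroup_axioms N(2)] by blast
    then show ?thesis
      using \<pi>.uniform_cyclic_group_factorization_extension[OF fin surj Cs] by (simp add: ker)
  qed
qed

lemma proper_uniform_group_factorization_exists:
  assumes G: "G \<in> groups_upto_dagger n"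
    and u: "uniform_cyclic_group_factorization G Hs"
  shows "\<exists>Hs. proper_factorization G Hs \<and> uniform_group_factorization G Hs"
proof (cases "cyclic_group G")
  case True
  then have "group G" "finite (carrier G)" "order G > 1" "\<not> primepow (order G)"
    using G by (simp_all add: groups_upto_dagger_def groups_upto_def)
  then show ?thesis
    using group.cyclic_coprime_factorization True by blast
next
  case False
  then have "\<not> cyclic_group (G\<lparr>carrier := carrier G\<rparr>)" by simp
  then have "carrier G \<notin> set Hs"
    using u unfolding uniform_cyclic_group_factorization_def by metis
  then have "proper_factorization G Hs \<and> uniform_group_factorization G Hs"
    using u unfolding uniform_cyclic_group_factorization_def uniform_factorization_def
      factorization_def proper_factorization_def uniform_group_factorization_def by blast
  then show ?thesis ..
qed

theorem theorem1p3:
  fixes n :: nat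
  assumes "n > 0"
  shows "((\<forall>G\<in>groups_upto n. \<exists>Hs. uniform_cyclic_group_factorization G Hs) \<longleftrightarrow>
          (\<forall>G\<in>groups_upto_dagger n. \<exists>Hs. proper_factorization G Hs \<and> uniform_group_factorization G Hs)) \<and>
         ((\<forall>G\<in>groups_upto_dagger n. \<exists>Hs. proper_factorization G Hs \<and> uniform_group_factorization G Hs) \<longleftrightarrow>
          (\<forall>G\<in>groups_upto_star n. \<exists>Hs. proper_factorization G Hs \<and> uniform_group_factorization G Hs))"
    (is "(?a \<longleftrightarrow> ?b) \<and> (_ \<longleftrightarrow> ?c)")
proof -
  have "?b" if "?a"
    using that proper_uniform_group_factorization_exists by (fastforce simp: groups_upto_dagger_def)
  moreover have "?c" if "?b"
    using that by (auto simp: groups_upto_star_def)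
  moreover have "?a" if "?c"
    using uniform_cyclic_group_factorization_exists[OF that] by (auto simp: groups_upto_def)
  ultimately show ?thesis by argo
qed

end
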